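(* Let $A:\mathbb{R}^n\to\mathbb{R}^n$ be linear and invertible, and let $f:\mathbb{R}^n\to\mathbb{R}\cup\{\infty\}$ be a proper, lower semicontinuous, convex function with $\mathrm{dom}\,f$ unbounded. Define $h:\mathbb{R}^n\to\mathbb{R}\cup\{\infty\}$ by $h(x):=f(Ax)$. Then $$\partial h(\infty)=A^\top[\partial f(\infty)].$$
   Context: For $\varphi:\mathbb{R}^n\to\mathbb{R}\cup\{\infty\}$: $\mathrm{dom}\,\varphi=\{x\mid\varphi(x)<\infty\}$; $\varphi$ is proper if $\mathrm{dom}\,\varphi\ne\emptyset$; $\mathrm{epi}\,\varphi=\{(x,r)\in\mathbb{R}^n\times\mathbb{R}\mid r\ge\varphi(x)\}$. For $\varphi$ proper, lower semicontinuous, convex with $\mathrm{dom}\,\varphi$ unbounded, and $I=\{1,\dots,n\}$ selecting the $x$-coordinates in $\mathbb{R}^n\times\mathbb{R}$: $T(\infty_I;\mathrm{epi}\,\varphi)$ is the set of $(w,\rho)$ such that for all sequences $(x_k,r_k)\in\mathrm{epi}\,\varphi$ with $\|x_k\|\to\infty$ and all $t_k>0$ with $t_k\to0$ there exist $(w_k,\rho_k)\to(w,\rho)$ with $(x_k,r_k)+t_k(w_k,\rho_k)\in\mathrm{epi}\,\varphi$ for all $k$. $N(\infty_I;\mathrm{epi}\,\varphi)=\{(u,c)\mid\langle u,w\rangle+c\rho\le0\ \forall(w,\rho)\in T(\infty_I;\mathrm{epi}\,\varphi)\}$, and $\partial\varphi(\infty)=\{u\mid(u,-1)\in N(\infty_I;\mathrm{epi}\,\varphi)\}$.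 *)

theory Defs
  imports "HOL-Analysis.Analysis"
begin

(* A function R^n -> R \<union> {\<infinity>} is an ereal-valued function that never takes the value
   -\<infinity>.  That side condition belongs to the codomain, so it is not part of the
   predicates below and has to be assumed separately. *)

definition eff_dom :: "('a \<Rightarrow> ereal) \<Rightarrow> 'a set" where
  "eff_dom \<phi> = {x. \<phi> x < \<infinity>}"

definition proper_fun :: "('a \<Rightarrow> ereal) \<Rightarrow> bool" where
  "proper_fun \<phi> \<longleftrightarrow> eff_dom \<phi> \<noteq> {}"

definition epi :: "('a \<Rightarrow> ereal) \<Rightarrow> ('a \<times> real) set" where
  "epi \<phi> = {(x, r). \<phi> x \<le> ereal r}"

definition lsc :: "('a::topological_space \<Rightarrow> ereal) \<Rightarrow> bool" where
  "lsc \<phi> \<longleftrightarrow> (\<forall>x. \<phi> x \<le> Liminf (at x) \<phi>)"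

(* In ereal, 0 * \<infinity> = 0, so the boundary cases u = 0 and v = 0 are harmless. *)
definition convex_fun :: "('a::real_vector \<Rightarrow> ereal) \<Rightarrow> bool" where
  "convex_fun \<phi> \<longleftrightarrow>
     (\<forall>x y. \<forall>u\<ge>0. \<forall>v\<ge>0. u + v = 1 \<longrightarrow>
        \<phi> (u *\<^sub>R x + v *\<^sub>R y) \<le> ereal u * \<phi> x + ereal v * \<phi> y)"

(* T(\<infinity>_I; C), where I selects the coordinates of the first factor: only the first
   component of the points of C is required to go to infinity. *)
definition tangent_cone_infty ::
    "('a::real_normed_vector \<times> real) set \<Rightarrow> ('a \<times> real) set" where
  "tangent_cone_infty C = {(w, \<rho>).
     \<forall>(x :: nat \<Rightarrow> 'a) (r :: nat \<Rightarrow> real) (t :: nat \<Rightarrow> real).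
       (\<forall>k. (x k, r k) \<in> C) \<and> filterlim (\<lambda>k. norm (x k)) at_top sequentially \<and>
       (\<forall>k. t k > 0) \<and> t \<longlonglongrightarrow> 0 \<longrightarrow>
       (\<exists>(w' :: nat \<Rightarrow> 'a) (\<rho>' :: nat \<Rightarrow> real).
          (\<lambda>k. (w' k, \<rho>' k)) \<longlonglongrightarrow> (w, \<rho>) \<and>
          (\<forall>k. (x k, r k) + t k *\<^sub>R (w' k, \<rho>' k) \<in> C))}"

definition normal_cone_infty ::
    "('a::real_inner \<times> real) set \<Rightarrow> ('a \<times> real) set" where
  "normal_cone_infty C = {(u, c). \<forall>(w, \<rho>) \<in> tangent_cone_infty C. u \<bullet> w + c * \<rho> \<le> 0}"

definition subdiff_infty :: "('a::real_inner \<Rightarrow> ereal) \<Rightarrow> 'a set" where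
  "subdiff_infty \<phi> = {u. (u, -1) \<in> normal_cone_infty (epi \<phi>)}"

end

theory Submission
  imports Defs
begin

text \<open>An invertible linear map distorts norms by at most a constant factor, so $A \times \mathrm{id}$
  identifies the sequences in epi h going to infinity with those in epi f, and hence
  the two tangent cones at infinity. Polarity then turns $A$ into its adjoint.\<close>

text \<open>Test sequences for \<open>f\<close> are pulled back along preimages under
  \<open>A\<close>, and the directions found there are pushed forward by \<open>A\<close>. With two
  spaces and a general surjection, the inverse of \<open>A\<close> can later take the place of
  \<open>A\<close>.\<close>

lemma tangent_cone_infty_epi_surj:
  fixes A :: "'a::euclidean_space \<Rightarrow> 'b::euclidean_space"
  assumes "linear A" and "surj A"
    and mem: "(w, \<rho>) \<in> tangent_cone_infty (epi (f \<circ> A))"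
  shows "(A w, \<rho>) \<in> tangent_cone_infty (epi f)"
  unfolding tangent_cone_infty_def
proof (clarify)
  fix x :: "nat \<Rightarrow> 'b" and r t :: "nat \<Rightarrow> real"
  assume x: "\<forall>k. (x k, r k) \<in> epi f" "filterlim (\<lambda>k. norm (x k)) at_top sequentially"
    and t: "\<forall>k. t k > 0" "t \<longlonglongrightarrow> 0"
  define y where "y k = inv A (x k)" for k
  have Ay: "A (y k) = x k" for k
    unfolding y_def by (rule surj_f_inv_f[OF \<open>surj A\<close>])
  have A: "bounded_linear A"
    using \<open>linear A\<close> by (simp add: linear_conv_bounded_linear)
  obtain K where K: "K > 0" "\<And>z. norm (A z) \<le> norm z * K"
    using bounded_linear.pos_bounded[OF A] by blast
  \<comment> \<open>An upper bound on \<open>A\<close> is a lower bound on preimages: norm (x k)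
    \<le> K * norm (y k), so any choice of preimages escapes to infinity along with
    \<open>x\<close>.\<close>
  have "filterlim (\<lambda>k. 1 / K * norm (x k)) at_top sequentially"
    using x(2) K(1) by (intro filterlim_tendsto_pos_mult_at_top[OF tendsto_const]) auto
  moreover have "1 / K * norm (x k) \<le> norm (y k)" for k
    using K(2)[of "y k"] K(1) by (simp add: Ay field_simps)
  ultimately have "filterlim (\<lambda>k. norm (y k)) at_top sequentially"
    by (elim filterlim_at_top_mono) simp
  moreover have "\<forall>k. (y k, r k) \<in> epi (f \<circ> A)"
    using x(1) by (simp add: epi_def Ay)
  ultimately obtain w' \<rho>' where w': "(\<lambda>k. (w' k, \<rho>' k)) \<longlonglongrightarrow> (w, \<rho>)"
      and epi: "\<And>k. (y k, r k) + t k *\<^sub>R (w' k, \<rho>' k) \<in> epi (f \<circ> A)"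
    using mem t unfolding tangent_cone_infty_def by blast
  have "(\<lambda>k. (A (w' k), \<rho>' k)) \<longlonglongrightarrow> (A w, \<rho>)"
    using tendsto_fst[OF w'] tendsto_snd[OF w']
    by (intro tendsto_Pair bounded_linear.tendsto[OF A]) auto
  \<comment> \<open>By linearity, the shifted point is the image under \<open>A\<close> of y k + t k
    * w' k, and the height is unchanged.\<close>
  moreover have "(x k, r k) + t k *\<^sub>R (A (w' k), \<rho>' k) \<in> epi f" for k
    using epi[of k] by (simp add: epi_def Ay linear_add[OF \<open>linear A\<close>] linear_scale[OF \<open>linear A\<close>])
  ultimately show "\<exists>w' \<rho>'. (\<lambda>k. (w' k, \<rho>' k)) \<longlonglongrightarrow> (A w, \<rho>) \<and>
      (\<forall>k. (x k, r k) + t k *\<^sub>R (w' k, \<rho>' k) \<in> epi f)"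
    by (intro exI[of _ "\<lambda>k. A (w' k)"] exI[of _ \<rho>']) auto
qed

text \<open>Each direction is an instance of the preceding lemma, once for \<open>A\<close> and once
  for its inverse \<open>B\<close>.\<close>

lemma tangent_cone_infty_epi_bij:
  fixes A :: "'a::euclidean_space \<Rightarrow> 'b::euclidean_space"
  assumes "linear A" and "bij A"
  shows "(w, \<rho>) \<in> tangent_cone_infty (epi (f \<circ> A)) \<longleftrightarrow>
    (A w, \<rho>) \<in> tangent_cone_infty (epi f)"
proof
  obtain B where B: "linear B" "B \<circ> A = id"
    using linear_injective_left_inverse[OF \<open>linear A\<close> bij_is_inj[OF \<open>bij A\<close>]] by blast
  have BA: "B (A z) = z" for z
    using B(2) by (rule pointfree_idE)
  have AB: "A (B z) = z" for z
    using surjD[OF bij_is_surj[OF \<open>bij A\<close>], of z] BA by auto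
  \<comment> \<open>In this form \<open>f\<close> is itself a composition with a linear surjection,
    with \<open>f \<circ> A\<close> as the outer function.\<close>
  have f: "(f \<circ> A) \<circ> B = f"
    by (simp add: fun_eq_iff AB)
  assume "(A w, \<rho>) \<in> tangent_cone_infty (epi f)"
  then have "(A w, \<rho>) \<in> tangent_cone_infty (epi ((f \<circ> A) \<circ> B))"
    by (simp only: f)
  from tangent_cone_infty_epi_surj[OF \<open>linear B\<close> surjI[of B, OF BA] this]
  show "(w, \<rho>) \<in> tangent_cone_infty (epi (f \<circ> A))"
    by (simp only: BA)
next
  assume "(w, \<rho>) \<in> tangent_cone_infty (epi (f \<circ> A))"
  with \<open>linear A\<close> bij_is_surj[OF \<open>bij A\<close>]
  show "(A w, \<rho>) \<in> tangent_cone_infty (epi f)"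
    by (rule tangent_cone_infty_epi_surj)
qed

text \<open>Moving the adjoint across the inner product turns the polar inequality at
  \<open>w\<close> for \<open>f \<circ> A\<close> into the one at \<open>A w\<close> for
  \<open>f\<close>.\<close>

lemma adjoint_mem_subdiff_infty_comp_iff:
  fixes A :: "'a::euclidean_space \<Rightarrow> 'b::euclidean_space"
  assumes "linear A" and "bij A"
  shows "adjoint A u \<in> subdiff_infty (f \<circ> A) \<longleftrightarrow> u \<in> subdiff_infty f"
proof -
  \<comment> \<open>As \<open>w\<close> varies, \<open>A w\<close> runs through the whole space, so
    testing at all \<open>A w\<close> is testing at all vectors.\<close>
  have "(\<forall>w. P (A w)) \<longleftrightarrow> (\<forall>v. P v)" for P :: "'b \<Rightarrow> bool"
    using bij_is_surj[OF \<open>bij A\<close>] by (metis surj_def)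
  from this[of "\<lambda>v. \<forall>\<rho>. (v, \<rho>) \<in> tangent_cone_infty (epi f) \<longrightarrow> u \<bullet> v - \<rho> \<le> 0"]
  show ?thesis
    by (simp add: subdiff_infty_def normal_cone_infty_def split_def
        tangent_cone_infty_epi_bij[OF assms] adjoint_clauses[OF \<open>linear A\<close>] Ball_def)
qed

text \<open>Transposing B A = id shows that the adjoint of a left inverse \<open>B\<close> is a
  right inverse of \<open>adjoint A\<close>.\<close>

lemma surj_adjoint:
  fixes A :: "'a::euclidean_space \<Rightarrow> 'b::euclidean_space"
  assumes "linear A" and "inj A"
  shows "surj (adjoint A)"
proof -
  obtain B where B: "linear B" "B \<circ> A = id"
    using linear_injective_left_inverse[OF assms] by blast
  have "adjoint A (adjoint B v) = v" for v
  proof (rule vector_eq_rdot[THEN iffD1], rule allI)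
    fix z
    show "adjoint A (adjoint B v) \<bullet> z = v \<bullet> z"
      using B by (simp add: adjoint_clauses[OF \<open>linear A\<close>] adjoint_clauses[OF B(1)] pointfree_idE)
  qed
  then show ?thesis
    by (rule surjI)
qed

theorem proposition4p21:
  fixes A :: "real ^ 'n \<Rightarrow> real ^ 'n"
    and f h :: "real ^ 'n \<Rightarrow> ereal"
  assumes "linear A" and "bij A"
    and "\<And>x. f x \<noteq> -\<infinity>"
    and "proper_fun f" and "lsc f" and "convex_fun f"
    and "\<not> bounded (eff_dom f)"
    and "\<And>x. h x = f (A x)"
  shows "subdiff_infty h = adjoint A ` subdiff_infty f"
proof -
  have h: "h = f \<circ> A"
    using assms(8) by (simp add: fun_eq_iff)
  have "adjoint A u \<in> subdiff_infty h \<longleftrightarrow> u \<in> subdiff_infty f" for u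
    unfolding h by (rule adjoint_mem_subdiff_infty_comp_iff[OF \<open>linear A\<close> \<open>bij A\<close>])
  \<comment> \<open>The equivalence speaks only of vectors of the form \<open>adjoint A u\<close>;
    surjectivity gives every element of \<open>subdiff_infty h\<close> this form.\<close>
  moreover have "surj (adjoint A)"
    using surj_adjoint[OF \<open>linear A\<close>] \<open>bij A\<close> by (simp add: bij_def)
  ultimately show ?thesis
    by (auto simp: image_iff) (metis surjD)
qed

end
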